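(* Let $\alpha\in(0,1)$ and $\rho=1/(1-\alpha)^2$. For every instance consisting only of $\alpha$-loose jobs that admits a feasible schedule on $m$ machines, the Earliest Deadline First algorithm using $\rho m$ machines produces a feasible schedule (every job completes by its deadline). That is, EDF is $1/(1-\alpha)^2$-competitive on such instances.
   Context: An instance is a finite set of jobs $J$; each job $j$ has processing time $p_j\in\mathbb{N}$, release date $r_j\in\mathbb{N}$, deadline $d_j\in\mathbb{N}$. A feasible schedule processes each job for $p_j$ time units within $[r_j,d_j)$, each machine processing at most one job at a time, no job on two machines simultaneously, with preemption and migration allowed. A job is $\alpha$-loose if $p_j\le\alpha(d_j-r_j)$. The (semi-online) algorithm EDF, given $m$ and using $m'=\rho m$ machines, processes at every integer time $t$, during $[t,t+1)$, the (at most $m'$) released unfinished jobs with smallest deadlines, ties broken arbitrarily; it learns each job only at its release date. *)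

theory Defs
  imports "HOL-Analysis.Analysis"
begin

text \<open>A schedule maps a machine and a point in (real) time to the job processed there, if any.
  With \<open>m\<close> machines, only the machines \<open>i < m\<close> are considered.\<close>

type_synonym 'j schedule = "nat \<Rightarrow> real \<Rightarrow> 'j option"

definition running :: "nat \<Rightarrow> 'j schedule \<Rightarrow> 'j \<Rightarrow> real set" where
  "running m \<sigma> j = {t. \<exists>i<m. \<sigma> i t = Some j}"

definition alpha_loose ::
  "real \<Rightarrow> ('j \<Rightarrow> nat) \<Rightarrow> ('j \<Rightarrow> nat) \<Rightarrow> ('j \<Rightarrow> nat) \<Rightarrow> 'j \<Rightarrow> bool" where
  "alpha_loose \<alpha> p r d j \<longleftrightarrow> real (p j) \<le> \<alpha> * (real (d j) - real (r j))"

definition non_parallel :: "nat \<Rightarrow> 'j schedule \<Rightarrow> bool" where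
  "non_parallel m \<sigma> \<longleftrightarrow>
     (\<forall>i<m. \<forall>i'<m. \<forall>t j. \<sigma> i t = Some j \<and> \<sigma> i' t = Some j \<longrightarrow> i = i')"

text \<open>Preemption and migration may occur at arbitrary real times; the only restriction is that
  each job occupies each machine on a measurable set of times, so that processing amounts make
  sense. Since no job runs in parallel with itself, the amount of processing of a job is the
  measure of the set of times at which it is running.\<close>

definition feasible_schedule ::
  "'j set \<Rightarrow> ('j \<Rightarrow> nat) \<Rightarrow> ('j \<Rightarrow> nat) \<Rightarrow> ('j \<Rightarrow> nat) \<Rightarrow> nat \<Rightarrow> 'j schedule \<Rightarrow> bool" where
  "feasible_schedule J p r d m \<sigma> \<longleftrightarrow>
     non_parallel m \<sigma> \<and>
     (\<forall>i<m. \<forall>t j. \<sigma> i t = Some j \<longrightarrow> j \<in> J \<and> real (r j) \<le> t \<and> t < real (d j)) \<and>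
     (\<forall>i<m. \<forall>j\<in>J. {t. \<sigma> i t = Some j} \<in> sets lebesgue) \<and>
     (\<forall>j\<in>J. measure lebesgue (running m \<sigma> j) = real (p j))"

text \<open>The released jobs of \<open>J\<close> that are not finished at the integer time \<open>n\<close>.
  Jobs that have missed their deadline stay available until they are finished.\<close>

definition available ::
  "'j set \<Rightarrow> ('j \<Rightarrow> nat) \<Rightarrow> ('j \<Rightarrow> nat) \<Rightarrow> nat \<Rightarrow> 'j schedule \<Rightarrow> nat \<Rightarrow> 'j set" where
  "available J p r m \<sigma> n =
     {j \<in> J. r j \<le> n \<and> measure lebesgue (running m \<sigma> j \<inter> {..<real n}) < real (p j)}"

definition processed_at :: "nat \<Rightarrow> 'j schedule \<Rightarrow> nat \<Rightarrow> 'j set" where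
  "processed_at m \<sigma> n = {j. \<exists>i<m. \<sigma> i (real n) = Some j}"

text \<open>The schedules that EDF can produce on \<open>m\<close> machines. This is a predicate rather than a
  function because ties between equal deadlines (and the choice of machines) are arbitrary. The
  decision at time \<open>n\<close> depends only on jobs released by time \<open>n\<close> and on the past.\<close>

definition EDF_schedule ::
  "'j set \<Rightarrow> ('j \<Rightarrow> nat) \<Rightarrow> ('j \<Rightarrow> nat) \<Rightarrow> ('j \<Rightarrow> nat) \<Rightarrow> nat \<Rightarrow> 'j schedule \<Rightarrow> bool" where
  "EDF_schedule J p r d m \<sigma> \<longleftrightarrow>
     non_parallel m \<sigma> \<and>
     (\<forall>i<m. \<forall>t<0. \<sigma> i t = None) \<and>
     (\<forall>i<m. \<forall>n. \<forall>t\<in>{real n..<real n + 1}. \<sigma> i t = \<sigma> i (real n)) \<and>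
     (\<forall>n. processed_at m \<sigma> n \<subseteq> available J p r m \<sigma> n \<and>
          card (processed_at m \<sigma> n) = min m (card (available J p r m \<sigma> n)) \<and>
          (\<forall>j\<in>processed_at m \<sigma> n. \<forall>k\<in>available J p r m \<sigma> n - processed_at m \<sigma> n. d j \<le> d k))"

end

theory Submission imports Defs begin

text \<open>
  Fix a deadline \<open>D\<close> and look only at the jobs due by \<open>D\<close>; EDF serves them as if the others did not
  exist. The lag of EDF at time \<open>t\<close> is the amount of work by which it is behind the given schedule on
  \<open>m\<close> machines. It is at most \<open>\<alpha> / (1 - \<alpha>) * m * (D - t)\<close>: if EDF processes at least \<open>m / (1 - \<alpha>)\<close>
  jobs just before \<open>t\<close>, the lag decreases as fast as the bound does. Otherwise all of the fewer than
  \<open>m / (1 - \<alpha>)\<close> available jobs are being processed. If each of them has at most \<open>\<alpha> * (D - t)\<close> work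
  left, the bound is immediate. If some job \<open>j\<close> has more, then by looseness it was processed for less
  than an \<open>\<alpha>\<close>-fraction of the time since its release; for the remaining fraction \<open>1 - \<alpha>\<close> all
  \<open>m / (1 - \<alpha>)\<^sup>2\<close> machines were busy, so the lag decreased at the rate of the bound on average since
  the release of \<open>j\<close>. At \<open>t = D\<close> the lag is at most 0, so no job due by \<open>D\<close> is late.
\<close>

section \<open>The lag bound over integer time slots\<close>

text \<open>The counting argument, freed from measure theory. \<open>K\<close> stands for the jobs
  due by \<open>D\<close>, \<open>P n\<close> for those of them that EDF runs in the slot [n, n +
  1), and \<open>e j n\<close> and \<open>opt j n\<close> for the work on \<open>j\<close> before
  time \<open>n\<close> by EDF and by the given schedule. Only \<open>opt\<close> is real-valued,
  since the given schedule may preempt at any real time. The deadline order enters solely through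
  \<open>P_busy\<close>.\<close>

locale lagging_busy_schedule =
  fixes K :: "'j set" and p r :: "'j \<Rightarrow> nat" and D m m' :: nat and \<alpha> :: real
    and P :: "nat \<Rightarrow> 'j set" and e :: "'j \<Rightarrow> nat \<Rightarrow> nat" and opt :: "'j \<Rightarrow> nat \<Rightarrow> real"
  assumes alpha_pos: "0 < \<alpha>" and alpha_less_1: "\<alpha> < 1"
    and enough_machines: "real m / (1 - \<alpha>)\<^sup>2 \<le> real m'"
    and finite_K: "finite K"
    and loose: "\<And>j. j \<in> K \<Longrightarrow> real (p j) \<le> \<alpha> * (real D - real (r j))"
    and e_0: "\<And>j. e j 0 = 0"
    and e_Suc: "\<And>j n. e j (Suc n) = e j n + (if j \<in> P n then 1 else 0)"
    and P_available: "\<And>n. P n \<subseteq> {j \<in> K. r j \<le> n \<and> e j n < p j}"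
    and P_busy: "\<And>n. {j \<in> K. r j \<le> n \<and> e j n < p j} \<subseteq> P n \<or> card (P n) = m'"
    and opt_unreleased: "\<And>j n. j \<in> K \<Longrightarrow> n \<le> r j \<Longrightarrow> opt j n = 0"
    and opt_le: "\<And>j n. j \<in> K \<Longrightarrow> opt j n \<le> real (p j)"
    and opt_speed: "\<And>s t. s \<le> t \<Longrightarrow> (\<Sum>j\<in>K. opt j t - opt j s) \<le> real m * (real t - real s)"
begin

definition lag :: "nat \<Rightarrow> real" where
  "lag t = (\<Sum>j\<in>K. opt j t - real (e j t))"

lemma e_eq_sum: "e j t = (\<Sum>k<t. if j \<in> P k then 1 else 0)"
  by (induction t) (simp_all add: e_0 e_Suc)

lemma e_diff_eq_card:
  assumes "s \<le> t"
  shows "e j t = e j s + card {k \<in> {s..<t}. j \<in> P k}"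
proof -
  have "(\<Sum>k<t. if j \<in> P k then 1 else 0) =
      (\<Sum>k<s. if j \<in> P k then 1 else 0) + (\<Sum>k\<in>{s..<t}. if j \<in> P k then 1 else (0::nat))"
    using assms sum.atLeastLessThan_concat[of 0 s t "\<lambda>k. if j \<in> P k then 1 else (0::nat)"]
    by (simp add: atLeast0LessThan)
  then show ?thesis
    by (simp add: e_eq_sum sum.If_cases Int_def)
qed

lemma e_unreleased:
  assumes "n \<le> r j"
  shows "e j n = 0"
proof -
  have "j \<notin> P k" if "k < n" for k
    using P_available[of k] that assms by auto
  then show ?thesis by (simp add: e_eq_sum)
qed

lemma e_le: "e j n \<le> p j"
proof (induction n)
  case (Suc n)
  then show ?case using P_available[of n] by (auto simp: e_Suc)
qed (simp add: e_0)

lemma e_mono: "s \<le> t \<Longrightarrow> e j s \<le> e j t"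
  by (simp add: e_diff_eq_card)

lemma P_subset_K: "P n \<subseteq> K"
  using P_available by blast

lemma sum_e_Suc: "(\<Sum>j\<in>K. e j (Suc n)) = (\<Sum>j\<in>K. e j n) + card (P n)"
  using P_subset_K[of n] finite_K
  by (simp add: e_Suc sum.distrib sum.If_cases Int_absorb1)

lemma sum_e_diff:
  assumes "s \<le> t"
  shows "(\<Sum>j\<in>K. e j t) = (\<Sum>j\<in>K. e j s) + (\<Sum>k\<in>{s..<t}. card (P k))"
  using assms by (induction t rule: dec_induct) (simp_all add: sum_e_Suc)

lemma lag_diff_le:
  assumes "s \<le> t"
  shows "lag t \<le> lag s + real m * (real t - real s) - real (\<Sum>k\<in>{s..<t}. card (P k))"
proof -
  have "lag t - lag s = (\<Sum>j\<in>K. opt j t - opt j s) - (real (\<Sum>j\<in>K. e j t) - real (\<Sum>j\<in>K. e j s))"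
    by (simp add: lag_def sum_subtractf)
  then show ?thesis
    using opt_speed[OF assms] sum_e_diff[OF assms] by simp
qed

text \<open>Whenever \<open>j\<close> is left waiting, \<open>P_busy\<close> makes \<open>m'\<close>
  jobs of \<open>K\<close> run. This happens in at least a fraction 1 - \<alpha> of the slots since
  the release, and (1 - \<alpha>) * m' is at least m / (1 - \<alpha>).\<close>

lemma busy_since_release:
  assumes "j \<in> K" "r j \<le> t" "e j t < p j" "real (e j t) \<le> \<alpha> * (real t - real (r j))"
  shows "real m / (1 - \<alpha>) * (real t - real (r j)) \<le> real (\<Sum>k\<in>{r j..<t}. card (P k))"
proof -
  let ?full = "{k \<in> {r j..<t}. j \<notin> P k}"
  \<comment> \<open>As \<open>e\<close> is monotone and \<open>j\<close> is unfinished at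
    \<open>t\<close>, it is available in every slot \<open>k\<close> considered, which rules out the
    first alternative of \<open>P_busy\<close>.\<close>
  have full: "card (P k) = m'" if "k \<in> ?full" for k
    using that P_busy[of k] assms e_mono[of k t j] by auto
  have "{r j..<t} = {k \<in> {r j..<t}. j \<in> P k} \<union> ?full" by auto
  then have "card {r j..<t} = card {k \<in> {r j..<t}. j \<in> P k} + card ?full"
    by (metis (no_types, lifting) card_Un_disjoint disjoint_iff finite_Un finite_atLeastLessThan
        mem_Collect_eq)
  then have "t - r j = e j t + card ?full"
    using e_diff_eq_card[OF assms(2), of j] e_unreleased[of "r j" j] by simp
  then have "(1 - \<alpha>) * (real t - real (r j)) \<le> real (card ?full)"
    using assms(2,4) by (simp add: algebra_simps of_nat_diff)
  then have "real m' * ((1 - \<alpha>) * (real t - real (r j))) \<le> real (m' * card ?full)"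
    by (simp add: mult_left_mono)
  moreover have "real (m' * card ?full) \<le> real (\<Sum>k\<in>{r j..<t}. card (P k))"
  proof (rule of_nat_mono)
    have "m' * card ?full = (\<Sum>k\<in>?full. card (P k))"
      using full by simp
    also have "\<dots> \<le> (\<Sum>k\<in>{r j..<t}. card (P k))"
      by (rule sum_mono2) auto
    finally show "m' * card ?full \<le> (\<Sum>k\<in>{r j..<t}. card (P k))" .
  qed
  moreover have "real m / (1 - \<alpha>) * (real t - real (r j))
      = real m / (1 - \<alpha>)\<^sup>2 * ((1 - \<alpha>) * (real t - real (r j)))"
    using alpha_less_1 by (simp add: power2_eq_square)
  moreover have "real m / (1 - \<alpha>)\<^sup>2 * ((1 - \<alpha>) * (real t - real (r j)))
      \<le> real m' * ((1 - \<alpha>) * (real t - real (r j)))"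
    using alpha_less_1 assms(2) enough_machines by (intro mult_right_mono) auto
  ultimately show ?thesis
    by linarith
qed

text \<open>The given schedule gains at most \<open>m\<close> per time unit, and m / (1 - \<alpha>)
  exceeds \<open>m\<close> by exactly the slope of the bound. An average of m / (1 - \<alpha>)
  running jobs per slot thus carries the bound from \<open>s\<close> to \<open>t\<close>.\<close>

lemma lag_le_if_decreasing:
  assumes "s \<le> t" "lag s \<le> \<alpha> / (1 - \<alpha>) * real m * (real D - real s)"
    and "real m / (1 - \<alpha>) * (real t - real s) \<le> real (\<Sum>k\<in>{s..<t}. card (P k))"
  shows "lag t \<le> \<alpha> / (1 - \<alpha>) * real m * (real D - real t)"
proof -
  define c where "c = \<alpha> / (1 - \<alpha>)"
  have rate: "real m / (1 - \<alpha>) = real m + c * real m"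
    using alpha_less_1 by (simp add: c_def field_simps)
  show ?thesis
    using lag_diff_le[OF assms(1)] assms(2,3) unfolding c_def[symmetric] rate
    by (simp add: algebra_simps)
qed

lemma lag_le:
  assumes "t \<le> D"
  shows "lag t \<le> \<alpha> / (1 - \<alpha>) * real m * (real D - real t)"
  using assms
\<comment> \<open>Strong induction, because one case goes back to the release date of a job instead
  of the previous slot.\<close>
proof (induction t rule: less_induct)
  case (less t)
  show ?case
  proof (cases t)
    case 0
    then show ?thesis
      using alpha_pos alpha_less_1 by (simp add: lag_def e_0 opt_unreleased)
  next
    case (Suc n)
    show ?thesis
    proof (cases "real m / (1 - \<alpha>) \<le> real (card (P n))")
      case True
      have "lag n \<le> \<alpha> / (1 - \<alpha>) * real m * (real D - real n)"
        using less Suc by simp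
      then show ?thesis
        using lag_le_if_decreasing[of n t] True Suc by simp
    next
      case few: False
      \<comment> \<open>Fewer than m / (1 - \<alpha>) running jobs are also fewer than
        \<open>m'\<close>, so no available job of \<open>K\<close> is waiting.\<close>
      have "real m / (1 - \<alpha>) \<le> real m / (1 - \<alpha>)\<^sup>2"
        using alpha_pos alpha_less_1
        by (intro divide_left_mono) (auto simp: power2_eq_square mult_left_le)
      then have "card (P n) \<noteq> m'"
        using few enough_machines by auto
      then have P: "{j \<in> K. r j \<le> n \<and> e j n < p j} \<subseteq> P n"
        using P_busy by blast
      \<comment> \<open>The strict \<open>r j < t\<close> lets the induction hypothesis apply at
        \<open>r j\<close>. It also means \<open>r j \<le> n\<close>, so every job of
        \<open>U\<close> was already available in slot \<open>n\<close>.\<close>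
      define U where "U = {j \<in> K. r j < t \<and> e j t < p j}"
      have U: "U \<subseteq> P n"
        using P e_mono[of n t] Suc by (force simp: U_def intro: le_less_trans)
      show ?thesis
      proof (cases "\<exists>j\<in>U. \<alpha> * (real D - real t) < real (p j) - real (e j t)")
        case True
        then obtain j where j: "j \<in> K" "r j < t" "e j t < p j"
          and large: "\<alpha> * (real D - real t) < real (p j) - real (e j t)"
          by (auto simp: U_def)
        \<comment> \<open>The remaining work exceeds \<alpha> * (D - t), while the total is at most
          \<alpha> * (D - r j); subtracting bounds the work already done.\<close>
        have "real (e j t) \<le> \<alpha> * (real t - real (r j))"
          using large loose[OF j(1)] by (simp add: algebra_simps)
        then show ?thesis
          using busy_since_release[of j t] lag_le_if_decreasing[of "r j" t] less j by simp
      next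
        case False
        \<comment> \<open>A job of \<open>U\<close> contributes at most its remaining work. Any
          other job contributes at most 0: either the given schedule has not started it, or EDF has
          finished it.\<close>
        have "lag t \<le> (\<Sum>j\<in>K. if j \<in> U then \<alpha> * (real D - real t) else 0)"
          unfolding lag_def
        proof (rule sum_mono)
          fix j assume j: "j \<in> K"
          then consider "j \<in> U" | "t \<le> r j" | "p j \<le> e j t"
            by (force simp: U_def)
          then show "opt j t - real (e j t) \<le> (if j \<in> U then \<alpha> * (real D - real t) else 0)"
          proof cases
            case 1
            then show ?thesis using False opt_le[OF j, of t] by force
          next
            case 2
            then show ?thesis using opt_unreleased[OF j, of t] by (simp add: U_def)
          next
            case 3
            then show ?thesis using opt_le[OF j, of t] by (simp add: U_def)
          qed
        qed
        also have "\<dots> = real (card U) * (\<alpha> * (real D - real t))"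
          using finite_K by (simp add: sum.If_cases U_def Int_def)
        also have "\<dots> \<le> real m / (1 - \<alpha>) * (\<alpha> * (real D - real t))"
        proof (rule mult_right_mono)
          have "card U \<le> card (P n)"
            using U P_subset_K finite_K by (meson card_mono finite_subset)
          then show "real (card U) \<le> real m / (1 - \<alpha>)"
            using few by linarith
          show "0 \<le> \<alpha> * (real D - real t)"
            using alpha_pos less.prems by simp
        qed
        finally show ?thesis by (simp add: ac_simps)
      qed
    qed
  qed
qed

text \<open>At \<open>D\<close> the bound is 0, so the remaining amounts of work, all nonnegative,
  have a sum of at most 0.\<close>

lemma finished_by_deadline:
  assumes "\<And>j. j \<in> K \<Longrightarrow> opt j D = real (p j)" and "j \<in> K"
  shows "e j D = p j"
proof -
  have "(\<Sum>j\<in>K. real (p j) - real (e j D)) \<le> 0"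
    using lag_le[of D] assms(1) by (simp add: lag_def)
  moreover have "\<And>j. 0 \<le> real (p j) - real (e j D)"
    using e_le by simp
  ultimately have "\<forall>j\<in>K. real (p j) - real (e j D) = 0"
    using finite_K by (meson order_antisym sum_nonneg sum_nonneg_eq_0_iff)
  then show ?thesis
    using assms(2) by simp
qed

end

section \<open>Lebesgue measure of running times\<close>

lemma running_eq_UN: "running m \<tau> j = (\<Union>i<m. {t. \<tau> i t = Some j})"
  by (auto simp: running_def)

lemma running_sets_lebesgue:
  assumes "\<And>i. i < m \<Longrightarrow> {t. \<tau> i t = Some j} \<in> sets lebesgue"
  shows "running m \<tau> j \<in> sets lebesgue"
  unfolding running_eq_UN using assms by (intro sets.countable_UN'') auto

lemma atLeastLessThan_lmeasurable: "{s..<t::real} \<in> lmeasurable"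
  by (intro bounded_set_imp_lmeasurable) auto

text \<open>\<open>measure\<close> is subtractive only on sets of finite measure;
  \<open>A \<subseteq> {0..}\<close> bounds the initial parts of \<open>A\<close> and thereby
  ensures this.\<close>

lemma measure_Int_lessThan_diff:
  fixes A :: "real set"
  assumes "A \<in> sets lebesgue" "A \<subseteq> {0..}" "s \<le> t"
  shows "measure lebesgue (A \<inter> {..<t}) - measure lebesgue (A \<inter> {..<s}) =
    measure lebesgue (A \<inter> {s..<t})"
proof -
  have lm: "A \<inter> {..<u} \<in> lmeasurable" for u
  proof -
    have "A \<inter> {..<u} = {0..<u} \<inter> A" using assms(2) by auto
    then show ?thesis
      using fmeasurable_Int_fmeasurable[OF atLeastLessThan_lmeasurable assms(1)] by simp
  qed
  have "A \<inter> {s..<t} = A \<inter> {..<t} - A \<inter> {..<s}" by auto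
  moreover have "measure lebesgue (A \<inter> {..<t} - A \<inter> {..<s}) =
      measure lebesgue (A \<inter> {..<t}) - measure lebesgue (A \<inter> {..<s})"
    using lm assms(3) by (intro measurable_measure_Diff) (auto simp: fmeasurableD)
  ultimately show ?thesis by simp
qed

text \<open>Summing machine by machine instead of job by job, each machine contributes at most the
  length of the interval.\<close>

lemma sum_measure_running_le:
  fixes s t :: real
  assumes "finite K" "s \<le> t"
    and meas: "\<And>i j. i < m \<Longrightarrow> j \<in> K \<Longrightarrow> {u. \<tau> i u = Some j} \<in> sets lebesgue"
  shows "(\<Sum>j\<in>K. measure lebesgue (running m \<tau> j \<inter> {s..<t})) \<le> real m * (t - s)"
proof -
  define B where "B i j = {u. \<tau> i u = Some j} \<inter> {s..<t}" for i j
  have B: "B i j \<in> lmeasurable" if "i < m" "j \<in> K" for i j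
    using fmeasurable_Int_fmeasurable[OF atLeastLessThan_lmeasurable meas[OF that]]
    by (simp add: B_def Int_commute)
  have "(\<Sum>j\<in>K. measure lebesgue (running m \<tau> j \<inter> {s..<t}))
      \<le> (\<Sum>j\<in>K. \<Sum>i<m. measure lebesgue (B i j))"
  proof (rule sum_mono)
    fix j assume "j \<in> K"
    then have "measure lebesgue (\<Union>i<m. B i j) \<le> (\<Sum>i<m. measure lebesgue (B i j))"
      using B by (intro measure_UNION_le) (auto simp: fmeasurableD)
    then show "measure lebesgue (running m \<tau> j \<inter> {s..<t}) \<le> (\<Sum>i<m. measure lebesgue (B i j))"
      by (simp add: running_eq_UN B_def)
  qed
  also have "\<dots> = (\<Sum>i<m. \<Sum>j\<in>K. measure lebesgue (B i j))"
    by (rule sum.swap)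
  also have "\<dots> \<le> (\<Sum>i<m. t - s)"
  proof (rule sum_mono)
    fix i assume "i \<in> {..<m}"
    then have i: "\<And>j. j \<in> K \<Longrightarrow> B i j \<in> lmeasurable" using B by auto
    \<comment> \<open>For distinct jobs the sets \<open>B i j\<close> are disjoint, as
      \<open>\<tau> i u\<close> is a single value.\<close>
    have "(\<Sum>j\<in>K. measure lebesgue (B i j)) = measure lebesgue (\<Union>j\<in>K. B i j)"
      using i assms(1)
      by (intro measure_UNION'[symmetric]) (auto simp: pairwise_def disjnt_def B_def)
    also have "\<dots> \<le> measure lebesgue {s..<t}"
      using i assms(1) atLeastLessThan_lmeasurable
      by (intro measure_mono_fmeasurable sets.finite_UN fmeasurableD) (auto simp: B_def)
    also have "\<dots> = t - s" using assms(2) by simp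
    finally show "(\<Sum>j\<in>K. measure lebesgue (B i j)) \<le> t - s" .
  qed
  finally show ?thesis by simp
qed

section \<open>Work done by a feasible schedule up to a given time\<close>

lemma feasible_schedule_running_subset:
  assumes "feasible_schedule J p r d m \<tau>"
  shows "running m \<tau> j \<subseteq> {real (r j)..<real (d j)}"
proof
  fix t assume "t \<in> running m \<tau> j"
  then obtain i where "i < m" "\<tau> i t = Some j"
    by (auto simp: running_def)
  then have "real (r j) \<le> t \<and> t < real (d j)"
    using assms unfolding feasible_schedule_def by blast
  then show "t \<in> {real (r j)..<real (d j)}"
    by simp
qed

lemma feasible_schedule_processed_eq:
  assumes "feasible_schedule J p r d m \<tau>" "j \<in> J" "d j \<le> n"
  shows "measure lebesgue (running m \<tau> j \<inter> {..<real n}) = real (p j)"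
proof -
  have "running m \<tau> j \<inter> {..<real n} = running m \<tau> j"
    using feasible_schedule_running_subset[OF assms(1), of j] assms(3) by force
  moreover have "measure lebesgue (running m \<tau> j) = real (p j)"
    using assms(1,2) unfolding feasible_schedule_def by blast
  ultimately show ?thesis by simp
qed

lemma feasible_schedule_unreleased:
  assumes "feasible_schedule J p r d m \<tau>" "n \<le> r j"
  shows "measure lebesgue (running m \<tau> j \<inter> {..<real n}) = 0"
proof -
  have "running m \<tau> j \<inter> {..<real n} = {}"
    using feasible_schedule_running_subset[OF assms(1), of j] assms(2) by force
  then show ?thesis by simp
qed

lemma feasible_schedule_processed_diff:
  assumes "feasible_schedule J p r d m \<tau>" "j \<in> J" "s \<le> t"
  shows "measure lebesgue (running m \<tau> j \<inter> {..<t}) - measure lebesgue (running m \<tau> j \<inter> {..<s}) =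
    measure lebesgue (running m \<tau> j \<inter> {s..<t})"
proof (rule measure_Int_lessThan_diff[OF _ _ assms(3)])
  show "running m \<tau> j \<in> sets lebesgue"
    using assms(1,2) unfolding feasible_schedule_def by (intro running_sets_lebesgue) blast
  show "running m \<tau> j \<subseteq> {0..}"
    using feasible_schedule_running_subset[OF assms(1), of j] by force
qed

lemma feasible_schedule_processed_le:
  assumes "feasible_schedule J p r d m \<tau>" "j \<in> J"
  shows "measure lebesgue (running m \<tau> j \<inter> {..<real n}) \<le> real (p j)"
proof -
  \<comment> \<open>A time not before \<open>n\<close> at which \<open>j\<close> is certainly
    complete.\<close>
  let ?N = "max n (d j)"
  have "measure lebesgue (running m \<tau> j \<inter> {..<real ?N}) = real (p j)"
    using assms by (intro feasible_schedule_processed_eq) auto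
  moreover have "measure lebesgue (running m \<tau> j \<inter> {..<real ?N}) -
      measure lebesgue (running m \<tau> j \<inter> {..<real n}) =
      measure lebesgue (running m \<tau> j \<inter> {real n..<real ?N})"
    using assms by (intro feasible_schedule_processed_diff) auto
  ultimately show ?thesis
    using measure_nonneg[of lebesgue "running m \<tau> j \<inter> {real n..<real ?N}"] by linarith
qed

section \<open>EDF schedules as sequences of unit slots\<close>

lemma EDF_schedule_slot:
  assumes "EDF_schedule J p r d m \<sigma>" "i < m" "t \<in> {real n..<real n + 1}"
  shows "\<sigma> i t = \<sigma> i (real n)"
  using assms unfolding EDF_schedule_def by blast

lemma EDF_schedule_processed:
  assumes "EDF_schedule J p r d m \<sigma>"
  shows "processed_at m \<sigma> n \<subseteq> available J p r m \<sigma> n"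
    and "card (processed_at m \<sigma> n) = min m (card (available J p r m \<sigma> n))"
    and "\<forall>j\<in>processed_at m \<sigma> n. \<forall>k\<in>available J p r m \<sigma> n - processed_at m \<sigma> n. d j \<le> d k"
  using assms unfolding EDF_schedule_def by blast+

text \<open>Every time is traced back to the start of its slot. The conjunct
  \<open>0 \<le> t\<close> is essential: \<open>nat\<close> would send negative times to slot
  0.\<close>

lemma EDF_schedule_Some_iff:
  assumes "EDF_schedule J p r d m \<sigma>" "i < m"
  shows "\<sigma> i t = Some j \<longleftrightarrow> 0 \<le> t \<and> \<sigma> i (real (nat \<lfloor>t\<rfloor>)) = Some j"
proof (cases "0 \<le> t")
  case True
  then have "\<sigma> i t = \<sigma> i (real (nat \<lfloor>t\<rfloor>))"
    by (intro EDF_schedule_slot[OF assms]) simp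
  then show ?thesis
    using True by simp
next
  case False
  then have "\<sigma> i t = None"
    using assms unfolding EDF_schedule_def by force
  then show ?thesis
    using False by simp
qed

lemma EDF_schedule_sets_lebesgue:
  assumes "EDF_schedule J p r d m \<sigma>" "i < m"
  shows "{t. \<sigma> i t = Some j} \<in> sets lebesgue"
proof -
  have "{t. \<sigma> i t = Some j} = (\<Union>n\<in>{n. \<sigma> i (real n) = Some j}. {real n..<real n + 1})"
    (is "_ = ?U")
  proof (intro equalityI subsetI)
    fix t assume "t \<in> {t. \<sigma> i t = Some j}"
    then have "0 \<le> t" "\<sigma> i (real (nat \<lfloor>t\<rfloor>)) = Some j"
      using EDF_schedule_Some_iff[OF assms] by blast+
    then show "t \<in> ?U"
      by (intro UN_I[of "nat \<lfloor>t\<rfloor>"]) auto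
  next
    fix t assume "t \<in> ?U"
    then obtain n where "\<sigma> i (real n) = Some j" "t \<in> {real n..<real n + 1}"
      by blast
    then show "t \<in> {t. \<sigma> i t = Some j}"
      using EDF_schedule_slot[OF assms, of t n] by simp
  qed
  also have "\<dots> \<in> sets lebesgue"
    by (intro sets.countable_UN'') auto
  finally show ?thesis .
qed

lemma EDF_schedule_running_iff:
  assumes "EDF_schedule J p r d m \<sigma>"
  shows "t \<in> running m \<sigma> j \<longleftrightarrow> 0 \<le> t \<and> j \<in> processed_at m \<sigma> (nat \<lfloor>t\<rfloor>)"
proof -
  have "(\<exists>i<m. \<sigma> i t = Some j) \<longleftrightarrow> (\<exists>i<m. 0 \<le> t \<and> \<sigma> i (real (nat \<lfloor>t\<rfloor>)) = Some j)"
    by (intro ex_cong1 conj_cong refl EDF_schedule_Some_iff[OF assms])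
  then show ?thesis
    unfolding running_def processed_at_def mem_Collect_eq by blast
qed

text \<open>Within slot \<open>n\<close> the running set of a job is either the whole slot or
  empty.\<close>

lemma EDF_schedule_processed_Suc:
  assumes "EDF_schedule J p r d m \<sigma>"
  shows "measure lebesgue (running m \<sigma> j \<inter> {..<real (Suc n)}) =
    measure lebesgue (running m \<sigma> j \<inter> {..<real n}) + (if j \<in> processed_at m \<sigma> n then 1 else 0)"
proof -
  have "running m \<sigma> j \<in> sets lebesgue"
    by (intro running_sets_lebesgue EDF_schedule_sets_lebesgue[OF assms])
  moreover have "running m \<sigma> j \<subseteq> {0..}"
    using EDF_schedule_running_iff[OF assms] by auto
  moreover have "running m \<sigma> j \<inter> {real n..<real (Suc n)} =
      (if j \<in> processed_at m \<sigma> n then {real n..<real (Suc n)} else {})"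
  proof -
    have "nat \<lfloor>t\<rfloor> = n" if "t \<in> {real n..<real (Suc n)}" for t
      using that by (intro nat_eq_iff[THEN iffD2]) (simp add: floor_eq_iff)
    moreover have "0 \<le> t" if "t \<in> {real n..<real (Suc n)}" for t
      using that by auto
    ultimately show ?thesis
      using EDF_schedule_running_iff[OF assms] by auto
  qed
  ultimately show ?thesis
    using measure_Int_lessThan_diff[of "running m \<sigma> j" "real n" "real (Suc n)"]
    by (cases "j \<in> processed_at m \<sigma> n") simp_all
qed

lemma EDF_schedule_processed_eq_card:
  assumes "EDF_schedule J p r d m \<sigma>"
  shows "measure lebesgue (running m \<sigma> j \<inter> {..<real n}) =
    real (card {k. k < n \<and> j \<in> processed_at m \<sigma> k})"
proof (induction n)
  case 0
  have "running m \<sigma> j \<inter> {..<real 0} = {}"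
    using EDF_schedule_running_iff[OF assms] by force
  then show ?case by simp
next
  case (Suc n)
  have "{k. k < Suc n \<and> j \<in> processed_at m \<sigma> k} =
      (if j \<in> processed_at m \<sigma> n then insert n else id) {k. k < n \<and> j \<in> processed_at m \<sigma> k}"
    by (auto simp: less_Suc_eq)
  then show ?case
    using Suc by (simp add: EDF_schedule_processed_Suc[OF assms] del: of_nat_Suc)
qed

section \<open>From the lag bound to feasibility of EDF\<close>

lemma EDF_schedule_finished_by_deadline:
  assumes "0 < \<alpha>" "\<alpha> < 1" "real m / (1 - \<alpha>)\<^sup>2 \<le> real m'" "finite J"
    and loose: "\<And>j. j \<in> J \<Longrightarrow> alpha_loose \<alpha> p r d j"
    and \<tau>: "feasible_schedule J p r d m \<tau>"
    and \<sigma>: "EDF_schedule J p r d m' \<sigma>"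
    and "j \<in> J"
  shows "measure lebesgue (running m' \<sigma> j \<inter> {..<real (d j)}) = real (p j)"
proof -
  define D where "D = d j"
  define K where "K = {k \<in> J. d k \<le> D}"
  define P where "P n = processed_at m' \<sigma> n \<inter> K" for n
  define e where "e k n = card {i. i < n \<and> k \<in> P i}" for k n
  have K: "K \<subseteq> J" by (auto simp: K_def)
  have e: "measure lebesgue (running m' \<sigma> k \<inter> {..<real n}) = real (e k n)" if "k \<in> K" for k n
    using that by (simp add: EDF_schedule_processed_eq_card[OF \<sigma>] e_def P_def)
  then have available: "{k \<in> K. r k \<le> n \<and> e k n < p k} = available J p r m' \<sigma> n \<inter> K" for n
    using K by (auto simp: available_def)
  note processed = EDF_schedule_processed(1)[OF \<sigma>]
    and number = EDF_schedule_processed(2)[OF \<sigma>]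
    and earliest = EDF_schedule_processed(3)[OF \<sigma>]
  interpret lagging_busy_schedule K p r D m m' \<alpha> P e
    "\<lambda>k n. measure lebesgue (running m \<tau> k \<inter> {..<real n})"
  proof
    fix n
    \<comment> \<open>Here the EDF rule is used: if an available \<open>k\<close> of
      \<open>K\<close> waits, all \<open>m'\<close> machines run jobs due no later than
      \<open>k\<close>. These lie in \<open>K\<close> too, so the restriction to \<open>K\<close>
      loses none of them.\<close>
    show "{k \<in> K. r k \<le> n \<and> e k n < p k} \<subseteq> P n \<or> card (P n) = m'"
    proof (rule disjCI)
      assume "card (P n) \<noteq> m'"
      have fin: "finite (available J p r m' \<sigma> n)"
        using assms(4) by (simp add: available_def)
      show "{k \<in> K. r k \<le> n \<and> e k n < p k} \<subseteq> P n"
      proof (rule ccontr)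
        assume "\<not> ?thesis"
        then obtain k where k: "k \<in> available J p r m' \<sigma> n - processed_at m' \<sigma> n" "k \<in> K"
          by (auto simp: available P_def)
        then have "processed_at m' \<sigma> n \<subset> available J p r m' \<sigma> n"
          using processed by blast
        then have "card (processed_at m' \<sigma> n) < card (available J p r m' \<sigma> n)"
          by (rule psubset_card_mono[OF fin])
        then have "card (processed_at m' \<sigma> n) = m'"
          using number[of n] by linarith
        moreover have "processed_at m' \<sigma> n \<subseteq> K"
        proof
          fix l assume l: "l \<in> processed_at m' \<sigma> n"
          then have "d l \<le> d k" using earliest k(1) by blast
          then show "l \<in> K"
            using l k(2) processed[of n] by (auto simp: K_def available_def)
        qed
        ultimately show False
          using \<open>card (P n) \<noteq> m'\<close> by (simp add: P_def Int_absorb2)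
      qed
    qed
  next
    fix k n
    show "e k (Suc n) = e k n + (if k \<in> P n then 1 else 0)"
    proof -
      have "{i. i < Suc n \<and> k \<in> P i} =
          (if k \<in> P n then insert n else id) {i. i < n \<and> k \<in> P i}"
        by (auto simp: less_Suc_eq)
      then show ?thesis by (simp add: e_def)
    qed
  next
    fix k assume k: "k \<in> K"
    then have "real (p k) \<le> \<alpha> * (real (d k) - real (r k))"
      using loose K by (auto simp: alpha_loose_def)
    also have "\<dots> \<le> \<alpha> * (real D - real (r k))"
      using k assms(1) by (simp add: K_def)
    finally show "real (p k) \<le> \<alpha> * (real D - real (r k))" .
  next
    fix s t :: nat assume st: "s \<le> t"
    have meas: "{u. \<tau> i u = Some k} \<in> sets lebesgue" if "i < m" "k \<in> K" for i k
      using \<tau> K that unfolding feasible_schedule_def by blast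
    have "(\<Sum>k\<in>K. measure lebesgue (running m \<tau> k \<inter> {..<real t})
        - measure lebesgue (running m \<tau> k \<inter> {..<real s}))
      = (\<Sum>k\<in>K. measure lebesgue (running m \<tau> k \<inter> {real s..<real t}))"
      using st K by (intro sum.cong feasible_schedule_processed_diff[OF \<tau>]) auto
    also have "\<dots> \<le> real m * (real t - real s)"
      using st finite_subset[OF K assms(4)] meas by (intro sum_measure_running_le) auto
    finally show "(\<Sum>k\<in>K. measure lebesgue (running m \<tau> k \<inter> {..<real t})
        - measure lebesgue (running m \<tau> k \<inter> {..<real s})) \<le> real m * (real t - real s)" .
  next
    show "P n \<subseteq> {k \<in> K. r k \<le> n \<and> e k n < p k}" for n
      unfolding available using processed by (auto simp: P_def)
  next
    show "finite K" using assms(4) K by (rule rev_finite_subset)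
  next
    show "e k 0 = 0" for k by (simp add: e_def)
  next
    fix k n assume "k \<in> K"
    then show "measure lebesgue (running m \<tau> k \<inter> {..<real n}) \<le> real (p k)"
      using K by (intro feasible_schedule_processed_le[OF \<tau>]) auto
  next
    show "measure lebesgue (running m \<tau> k \<inter> {..<real n}) = 0" if "n \<le> r k" for k n
      using \<tau> that by (rule feasible_schedule_unreleased)
  qed (fact assms)+
  have "j \<in> K" using assms(8) by (simp add: K_def D_def)
  then have "e j D = p j"
    using feasible_schedule_processed_eq[OF \<tau>] by (intro finished_by_deadline) (auto simp: K_def)
  then show ?thesis
    using e[OF \<open>j \<in> K\<close>, of D] by (simp add: D_def)
qed

text \<open>Late jobs remain available to EDF, so running inside the windows is not built in. It
  follows from punctual completion, since EDF runs only unfinished jobs.\<close>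

lemma EDF_schedule_feasible:
  assumes \<sigma>: "EDF_schedule J p r d m \<sigma>"
    and finished: "\<And>j. j \<in> J \<Longrightarrow> measure lebesgue (running m \<sigma> j \<inter> {..<real (d j)}) = real (p j)"
  shows "feasible_schedule J p r d m \<sigma>"
proof -
  have window: "j \<in> J \<and> real (r j) \<le> t \<and> t < real (d j)" if "t \<in> running m \<sigma> j" for j t
  proof -
    define n where "n = nat \<lfloor>t\<rfloor>"
    have t: "0 \<le> t" and "j \<in> processed_at m \<sigma> n"
      using that EDF_schedule_running_iff[OF \<sigma>] by (auto simp: n_def)
    then have "j \<in> available J p r m \<sigma> n"
      using EDF_schedule_processed(1)[OF \<sigma>] by blast
    then have j: "j \<in> J" "r j \<le> n"
      and unfinished: "measure lebesgue (running m \<sigma> j \<inter> {..<real n}) < real (p j)"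
      by (auto simp: available_def)
    \<comment> \<open>Otherwise the work before \<open>n\<close> would include all the work before
      \<open>d j\<close>, which is already \<open>p j\<close>. Since both are integers, the whole
      slot then ends by \<open>d j\<close>.\<close>
    have "n < d j"
    proof (rule ccontr)
      assume "\<not> n < d j"
      then have "card {k. k < d j \<and> j \<in> processed_at m \<sigma> k} \<le> card {k. k < n \<and> j \<in> processed_at m \<sigma> k}"
        by (intro card_mono) auto
      then show False
        using unfinished finished[OF j(1)] by (simp add: EDF_schedule_processed_eq_card[OF \<sigma>])
    qed
    moreover have "real n \<le> t" "t < real n + 1"
      using t by (auto simp: n_def)
    ultimately show ?thesis
      using j by linarith
  qed
  moreover have "measure lebesgue (running m \<sigma> j) = real (p j)" if "j \<in> J" for j
  proof -
    have "running m \<sigma> j \<inter> {..<real (d j)} = running m \<sigma> j"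
      using window by auto
    then show ?thesis using finished[OF that] by simp
  qed
  moreover have "non_parallel m \<sigma>"
    using \<sigma> unfolding EDF_schedule_def by blast
  moreover have "t \<in> running m \<sigma> j" if "i < m" "\<sigma> i t = Some j" for i t j
    using that unfolding running_def by blast
  ultimately show ?thesis
    using EDF_schedule_sets_lebesgue[OF \<sigma>] unfolding feasible_schedule_def by blast
qed

theorem theorem3:
  fixes \<alpha> \<rho> :: real and J :: "'j set" and p r d :: "'j \<Rightarrow> nat" and m :: nat
    and \<sigma> :: "'j schedule"
  assumes "0 < \<alpha>" and "\<alpha> < 1" and "\<rho> = 1 / (1 - \<alpha>)\<^sup>2"
    and "finite J"
    and "\<And>j. j \<in> J \<Longrightarrow> alpha_loose \<alpha> p r d j"
    and "\<exists>\<tau>. feasible_schedule J p r d m \<tau>"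
    and "EDF_schedule J p r d (nat \<lceil>\<rho> * real m\<rceil>) \<sigma>"
  shows "feasible_schedule J p r d (nat \<lceil>\<rho> * real m\<rceil>) \<sigma>"
proof -
  obtain \<tau> where \<tau>: "feasible_schedule J p r d m \<tau>"
    using assms(6) by blast
  \<comment> \<open>Rounding up the number of machines preserves the lower bound that the argument
    needs.\<close>
  have machines: "real m / (1 - \<alpha>)\<^sup>2 \<le> real (nat \<lceil>\<rho> * real m\<rceil>)"
    using assms(3) by (simp add: real_nat_ceiling_ge)
  show ?thesis
    using EDF_schedule_finished_by_deadline[OF assms(1,2) machines assms(4,5) \<tau> assms(7)]
    by (rule EDF_schedule_feasible[OF assms(7)])
qed

end
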